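(* Let $M\subset\mathbb{C}$ be a connected, simply connected domain, let $L=1+\mathrm{i}e_1\in\mathbb{H}_{\mathbb{C}}$, let $A,B\colon M\to\operatorname{Sp}(1,\mathbb{C})$ be holomorphic, set $\Phi=ALB$, and let $X=\operatorname{Re}\int\Phi\,\mathrm{d}z\colon M\to\mathbb{R}^4$ be the associated conformal minimal immersion. Then $X$ is superminimal if and only if one of the two (spinorial) components $M\to\mathbb{CP}^1$ of the generalised Gauss map $[\Phi]\colon M\to Q^2\simeq\mathbb{CP}^1\times\mathbb{CP}^1$ is constant.
   Context: $\mathbb{H}_{\mathbb{C}}:=\mathbb{H}\otimes_{\mathbb{R}}\mathbb{C}$ is the algebra of complex quaternions: elements $q=q_0+q_1e_1+q_2e_2+q_3e_3$ with $q_j\in\mathbb{C}$, where the imaginary unit $\mathrm{i}\in\mathbb{C}$ commutes with $e_1,e_2,e_3$, and $e_1^2=e_2^2=e_3^2=-1$, $e_1e_2=e_3=-e_2e_1$, $e_2e_3=e_1=-e_3e_2$, $e_3e_1=e_2=-e_1e_3$. The conjugate is $q^c:=q_0-q_1e_1-q_2e_2-q_3e_3$ and the symmetrised norm is $q^s:=qq^c=q_0^2+q_1^2+q_2^2+q_3^2$. $\operatorname{Sp}(1,\mathbb{C}):=\{q\in\mathbb{H}_{\mathbb{C}}: q^s=1\}$. $\mathbb{H}_{\mathbb{C}}$ is identified with $\mathbb{C}^4$ via $q\leftrightarrow(q_0,q_1,q_2,q_3)$; $\operatorname{Re}$ is the componentwise real part $\mathbb{C}^4\to\mathbb{R}^4$,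 and $\int\Phi\,\mathrm{d}z$ denotes a holomorphic primitive of $\Phi$ on $M$ (up to an additive constant). The algebra isomorphism $\Psi\colon\mathbb{H}_{\mathbb{C}}\to\mathrm{Mat}_{2\times2}(\mathbb{C})$, $\Psi(q)=\begin{pmatrix}q_0+\mathrm{i}q_1&q_2+\mathrm{i}q_3\\-q_2+\mathrm{i}q_3&q_0-\mathrm{i}q_1\end{pmatrix}$, satisfies $\det\Psi(q)=q^s$. The projective null quadric is $Q^2=\{[q]\in\mathbb{CP}^3: q^s=0\}$. For non-zero null $q$, $\Psi(q)$ has rank one, $\Psi(q)=uv^t$ with $u,v\in\mathbb{C}^2\setminus\{0\}$, and $[q]\mapsto([u],[v])$ is the (Segre) identification $Q^2\simeq\mathbb{CP}^1\times\mathbb{CP}^1$. The generalised Gauss map of $X$ is $[\Phi]\colon M\to Q^2$, with $\Phi=2X_z$; its two spinorial components are the resulting maps $[u],[v]\colon M\to\mathbb{CP}^1$. With $z=u+\mathrm{i}v$ (here $u,v$ real coordinates), an immersion $X\colon M\to\mathbb{R}^4$ is conformal if $|X_u|^2=|X_v|^2=:e^{2\omega}$ and $\langle X_u,X_v\rangle=0$; it is minimal if moreover $X_{uu}+X_{vv}=0$ (equivalently the mean curvature vector vanishes). With $(\cdot)^\perp$ the orthogonal projection to the normal plane, put $\xi=\tfrac12e^{-2\omega}(X_{uu}-X_{vv})^\perp$ and $\eta=e^{-2\omega}(X_{uv})^\perp$. The curvature ellipse at a point is the image of the unit tangent circle under $w\mapsto\mathrm{II}(w,w)$, with $\mathrm{II}$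 the second fundamental form; it is $\{\mathbf H+\xi\cos2\theta+\eta\sin2\theta\}$, where $\mathbf H$ is the mean curvature vector, and is called a circle (possibly degenerate to a point) iff $\langle\xi,\eta\rangle=0$ and $|\xi|=|\eta|$. A conformal immersion is superminimal if it is minimal and its curvature ellipse is a circle at every point. *)

theory Defs
  imports "HOL-Analysis.Analysis"
begin

section \<open>Complex quaternions\<close>

text \<open>The algebra of complex quaternions is carried by \<open>complex ^ 4\<close>, with the four indices
  written \<open>0, 1, 2, 3\<close> (in the library's type \<open>4\<close>, which has elements \<open>1, 2, 3, 4\<close>,
  the index \<open>0\<close> is the same as \<open>4\<close>).  The product is \<open>\<odot>\<close>; the library's \<open>*\<close> on
  this type is the componentwise product and is not used.\<close>

type_synonym cquat = "complex ^ 4"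

definition cquat :: "complex \<Rightarrow> complex \<Rightarrow> complex \<Rightarrow> complex \<Rightarrow> cquat" where
  "cquat a b c d = (\<chi> i. if i = 0 then a else if i = 1 then b else if i = 2 then c else d)"

definition qmul :: "cquat \<Rightarrow> cquat \<Rightarrow> cquat" (infixl "\<odot>" 70) where
  "p \<odot> q = cquat
     (p$0 * q$0 - p$1 * q$1 - p$2 * q$2 - p$3 * q$3)
     (p$0 * q$1 + p$1 * q$0 + p$2 * q$3 - p$3 * q$2)
     (p$0 * q$2 - p$1 * q$3 + p$2 * q$0 + p$3 * q$1)
     (p$0 * q$3 + p$1 * q$2 - p$2 * q$1 + p$3 * q$0)"

definition qconj :: "cquat \<Rightarrow> cquat" where
  "qconj q = cquat (q$0) (- q$1) (- q$2) (- q$3)"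

definition qsym :: "cquat \<Rightarrow> complex" where
  "qsym q = (q$0)\<^sup>2 + (q$1)\<^sup>2 + (q$2)\<^sup>2 + (q$3)\<^sup>2"

definition Sp1C :: "cquat set" where
  "Sp1C = {q. qsym q = 1}"

definition qL :: cquat where
  "qL = cquat 1 \<i> 0 0"

lemma cquat_nth [simp]:
  "cquat a b c d $ 0 = a" "cquat a b c d $ 1 = b" "cquat a b c d $ 2 = c" "cquat a b c d $ 3 = d"
  by (simp_all add: cquat_def)

lemma forall_index4: "(\<forall>i::4. P i) \<longleftrightarrow> P 0 \<and> P 1 \<and> P 2 \<and> P 3"
proof -
  have "(4::4) = 0" by simp
  then show ?thesis unfolding forall_4 by metis
qed

lemma cquat_eq_iff:
  "(p::cquat) = q \<longleftrightarrow> p$0 = q$0 \<and> p$1 = q$1 \<and> p$2 = q$2 \<and> p$3 = q$3"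
  by (simp add: vec_eq_iff forall_index4)

lemma qmul_units:
  defines "e0 \<equiv> cquat 1 0 0 0" and "e1 \<equiv> cquat 0 1 0 0"
    and "e2 \<equiv> cquat 0 0 1 0" and "e3 \<equiv> cquat 0 0 0 1"
  shows "e0 \<odot> q = q" "q \<odot> e0 = q"
    "e1 \<odot> e1 = - e0" "e2 \<odot> e2 = - e0" "e3 \<odot> e3 = - e0"
    "e1 \<odot> e2 = e3" "e2 \<odot> e1 = - e3" "e2 \<odot> e3 = e1" "e3 \<odot> e2 = - e1"
    "e3 \<odot> e1 = e2" "e1 \<odot> e3 = - e2"
  by (simp_all add: assms cquat_eq_iff qmul_def)

lemma qmul_qconj: "q \<odot> qconj q = cquat (qsym q) 0 0 0"
  by (simp add: cquat_eq_iff qmul_def qconj_def qsym_def power2_eq_square algebra_simps)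

definition qRe :: "cquat \<Rightarrow> real ^ 4" where
  "qRe q = (\<chi> j. Re (q $ j))"

definition holomorphic_vec_on :: "(complex \<Rightarrow> complex ^ 'n) \<Rightarrow> complex set \<Rightarrow> bool" where
  "holomorphic_vec_on f M \<longleftrightarrow> (\<forall>j. (\<lambda>z. f z $ j) holomorphic_on M)"

definition holomorphic_primitive_on ::
    "(complex \<Rightarrow> complex ^ 'n) \<Rightarrow> (complex \<Rightarrow> complex ^ 'n) \<Rightarrow> complex set \<Rightarrow> bool" where
  "holomorphic_primitive_on F f M \<longleftrightarrow>
     (\<forall>j. \<forall>z\<in>M. ((\<lambda>w. F w $ j) has_field_derivative f z $ j) (at z))"


section \<open>The null quadric and its Segre identification\<close>

text \<open>A point of a complex projective space is the set of non-zero multiples of a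
  non-zero vector.\<close>

definition proj_class :: "complex ^ 'n \<Rightarrow> (complex ^ 'n) set" where
  "proj_class x = {c *s x | c. c \<noteq> 0}"

definition Psi :: "cquat \<Rightarrow> complex ^ 2 ^ 2" where
  "Psi q = vector [vector [q$0 + \<i> * q$1, q$2 + \<i> * q$3],
                   vector [- q$2 + \<i> * q$3, q$0 - \<i> * q$1]]"

lemma det_Psi: "det (Psi q) = qsym q"
  by (simp add: det_2 Psi_def qsym_def algebra_simps power2_eq_square)

text \<open>The matrix \<open>u v\<^sup>t\<close>.\<close>
definition outer :: "complex ^ 2 \<Rightarrow> complex ^ 2 \<Rightarrow> complex ^ 2 ^ 2" where
  "outer u v = (\<chi> i j. u $ i * v $ j)"

text \<open>For a point \<open>p = [q]\<close> of the null quadric, \<open>segre p = ([u], [v])\<close> where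
  \<open>Psi q = u v\<^sup>t\<close>; see \<open>segre_eq\<close> and \<open>null_Psi_rank_one\<close> below.\<close>
definition segre :: "cquat set \<Rightarrow> (complex ^ 2) set \<times> (complex ^ 2) set" where
  "segre p = (THE s. \<exists>q u v. p = proj_class q \<and> q \<noteq> 0 \<and> qsym q = 0 \<and> u \<noteq> 0 \<and> v \<noteq> 0 \<and>
                        Psi q = outer u v \<and> s = (proj_class u, proj_class v))"

lemma proj_class_scale:
  assumes "c \<noteq> 0" shows "proj_class (c *s x) = proj_class x"
proof -
  have "\<exists>d. a *s x = d *s (c *s x) \<and> d \<noteq> 0" if "a \<noteq> 0" for a
    using that assms by (intro exI[of _ "a / c"]) simp
  moreover have "\<exists>d. a *s (c *s x) = d *s x \<and> d \<noteq> 0" if "a \<noteq> 0" for a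
    using that assms by (intro exI[of _ "a * c"]) simp
  ultimately show ?thesis by (auto simp: proj_class_def)
qed

lemma outer_proportional:
  assumes "\<And>i j. outer u v $ i $ j = c * outer u' v' $ i $ j" "u \<noteq> 0" "v \<noteq> 0"
  shows "proj_class u = proj_class u' \<and> proj_class v = proj_class v'"
proof -
  have e: "u $ i * v $ j = c * (u' $ i * v' $ j)" for i j
    using assms(1)[of i j] by (simp add: outer_def)
  obtain i where i: "u $ i \<noteq> 0" using assms(2) by (auto simp: vec_eq_iff)
  obtain j where j: "v $ j \<noteq> 0" using assms(3) by (auto simp: vec_eq_iff)
  have "c * (u' $ i * v' $ j) \<noteq> 0" using i j e[of i j] by (metis mult_eq_0_iff)
  then have n: "c \<noteq> 0" "u' $ i \<noteq> 0" "v' $ j \<noteq> 0" by auto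
  have "u $ k = (c * v' $ j / v $ j) * u' $ k" for k
    using j e[of k j] by (simp add: nonzero_eq_divide_eq mult_ac)
  then have "u = (c * v' $ j / v $ j) *s u'" by (simp add: vec_eq_iff)
  moreover have "v $ k = (c * u' $ i / u $ i) * v' $ k" for k
    using i e[of i k] by (simp add: nonzero_eq_divide_eq mult_ac)
  then have "v = (c * u' $ i / u $ i) *s v'" by (simp add: vec_eq_iff)
  moreover have "c * v' $ j / v $ j \<noteq> 0" "c * u' $ i / u $ i \<noteq> 0"
    using n i j by auto
  ultimately obtain k l where kl: "u = k *s u'" "v = l *s v'" "k \<noteq> 0" "l \<noteq> 0" by blast
  show ?thesis unfolding kl(1,2) using kl(3,4) by (simp add: proj_class_scale)
qed

lemma segre_eq:
  assumes "q \<noteq> 0" "qsym q = 0" "u \<noteq> 0" "v \<noteq> 0" "Psi q = outer u v"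
  shows "segre (proj_class q) = (proj_class u, proj_class v)"
  unfolding segre_def
proof (rule the_equality)
  show "\<exists>q' u' v'. proj_class q = proj_class q' \<and> q' \<noteq> 0 \<and> qsym q' = 0 \<and> u' \<noteq> 0 \<and> v' \<noteq> 0 \<and>
          Psi q' = outer u' v' \<and> (proj_class u, proj_class v) = (proj_class u', proj_class v')"
    using assms by blast
next
  fix s
  assume "\<exists>q' u' v'. proj_class q = proj_class q' \<and> q' \<noteq> 0 \<and> qsym q' = 0 \<and> u' \<noteq> 0 \<and> v' \<noteq> 0 \<and>
          Psi q' = outer u' v' \<and> s = (proj_class u', proj_class v')"
  then obtain q' u' v' where h: "proj_class q = proj_class q'" "u' \<noteq> 0" "v' \<noteq> 0"
    "Psi q' = outer u' v'" "s = (proj_class u', proj_class v')" by blast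
  have "q' = 1 *s q'" by simp
  then have "q' \<in> proj_class q'" unfolding proj_class_def
    by (intro CollectI exI[of _ "1 :: complex"] conjI) simp_all
  then have "q' \<in> proj_class q" using h(1) by simp
  then obtain c where c: "q' = c *s q" by (auto simp: proj_class_def)
  have "Psi q' $ i $ j = c * Psi q $ i $ j" for i j
    using exhaust_2[of i] exhaust_2[of j] by (auto simp: c Psi_def algebra_simps)
  then have "outer u' v' $ i $ j = c * outer u v $ i $ j" for i j using assms h by simp
  then show "s = (proj_class u, proj_class v)"
    using outer_proportional[of u' v' c u v] h by simp
qed

lemma null_Psi_rank_one:
  assumes "q \<noteq> 0" "qsym q = 0"
  shows "\<exists>u v. u \<noteq> 0 \<and> v \<noteq> 0 \<and> Psi q = outer u v"
proof -
  define a b c d where abcd: "a = q$0 + \<i> * q$1" "b = q$2 + \<i> * q$3"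
    "c = - q$2 + \<i> * q$3" "d = q$0 - \<i> * q$1"
  have P: "Psi q = vector [vector [a, b], vector [c, d]]" by (simp add: Psi_def abcd)
  have det: "a * d = b * c" using det_Psi[of q] assms(2) by (simp add: P det_2)
  have q: "2 * q$0 = a + d" "2 * \<i> * q$1 = a - d" "2 * q$2 = b - c" "2 * \<i> * q$3 = b + c"
    by (simp_all add: abcd)
  have nz: "\<not> (a = 0 \<and> b = 0 \<and> c = 0 \<and> d = 0)"
    using q assms(1) by (auto simp: cquat_eq_iff)
  have V: "vector [x, y] \<noteq> (0 :: complex ^ 2)" if "x \<noteq> 0 \<or> y \<noteq> 0" for x y :: complex
    using that by (auto simp: vec_eq_iff forall_2)
  consider "a \<noteq> 0" | "a = 0" "b \<noteq> 0" | "a = 0" "b = 0" by blast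
  then show ?thesis
  proof cases
    case 1
    have "d = c / a * b" using 1 det by (simp add: nonzero_eq_divide_eq mult.commute)
    then have "Psi q = outer (vector [1, c / a]) (vector [a, b])"
      using 1 by (simp add: P outer_def vec_eq_iff forall_2)
    moreover have "vector [1, c / a] \<noteq> (0 :: complex ^ 2)" "vector [a, b] \<noteq> (0 :: complex ^ 2)"
      by (rule V, use 1 in simp)+
    ultimately show ?thesis by blast
  next
    case 2
    then have "c = 0" using det by simp
    then have "Psi q = outer (vector [1, d / b]) (vector [a, b])"
      using 2 by (simp add: P outer_def vec_eq_iff forall_2)
    moreover have "vector [1, d / b] \<noteq> (0 :: complex ^ 2)" "vector [a, b] \<noteq> (0 :: complex ^ 2)"
      by (rule V, use 2 in simp)+
    ultimately show ?thesis by blast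
  next
    case 3
    then have "Psi q = outer (vector [0, 1]) (vector [c, d])"
      by (simp add: P outer_def vec_eq_iff forall_2)
    moreover have "vector [0, 1] \<noteq> (0 :: complex ^ 2)"
      by (rule V) simp
    moreover have "vector [c, d] \<noteq> (0 :: complex ^ 2)"
      by (rule V, use 3 nz in blast)
    ultimately show ?thesis by blast
  qed
qed


section \<open>Surfaces in Euclidean four-space\<close>

text \<open>Partial derivatives with respect to the real and the imaginary part of the
  coordinate \<open>z = u + \<i> v\<close>.\<close>

definition d_u :: "(complex \<Rightarrow> real ^ 'n) \<Rightarrow> complex \<Rightarrow> real ^ 'n" where
  "d_u X z = frechet_derivative X (at z) 1"

definition d_v :: "(complex \<Rightarrow> real ^ 'n) \<Rightarrow> complex \<Rightarrow> real ^ 'n" where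
  "d_v X z = frechet_derivative X (at z) \<i>"

primrec Ck_on :: "nat \<Rightarrow> (complex \<Rightarrow> real ^ 'n) \<Rightarrow> complex set \<Rightarrow> bool" where
  "Ck_on 0 X M \<longleftrightarrow> continuous_on M X"
| "Ck_on (Suc k) X M \<longleftrightarrow>
     (\<forall>z\<in>M. X differentiable (at z)) \<and> Ck_on k (d_u X) M \<and> Ck_on k (d_v X) M"

definition smooth_on :: "(complex \<Rightarrow> real ^ 'n) \<Rightarrow> complex set \<Rightarrow> bool" where
  "smooth_on X M \<longleftrightarrow> (\<forall>k. Ck_on k X M)"

definition immersion_on :: "(complex \<Rightarrow> real ^ 'n) \<Rightarrow> complex set \<Rightarrow> bool" where
  "immersion_on X M \<longleftrightarrow> smooth_on X M \<and> (\<forall>z\<in>M. inj (frechet_derivative X (at z)))"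

definition conformal_immersion_on :: "(complex \<Rightarrow> real ^ 'n) \<Rightarrow> complex set \<Rightarrow> bool" where
  "conformal_immersion_on X M \<longleftrightarrow> immersion_on X M \<and>
     (\<forall>z\<in>M. (norm (d_u X z))\<^sup>2 = (norm (d_v X z))\<^sup>2 \<and> d_u X z \<bullet> d_v X z = 0)"

definition minimal_immersion_on :: "(complex \<Rightarrow> real ^ 'n) \<Rightarrow> complex set \<Rightarrow> bool" where
  "minimal_immersion_on X M \<longleftrightarrow> conformal_immersion_on X M \<and>
     (\<forall>z\<in>M. d_u (d_u X) z + d_v (d_v X) z = 0)"

definition orth_proj :: "(real ^ 'n) set \<Rightarrow> real ^ 'n \<Rightarrow> real ^ 'n" where
  "orth_proj W y = (THE p. p \<in> W \<and> y - p \<in> W\<^sup>\<bottom>)"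

lemma orth_proj_eq:
  fixes W :: "(real ^ 'n) set"
  assumes "subspace W" "p \<in> W" "y - p \<in> W\<^sup>\<bottom>"
  shows "orth_proj W y = p"
  unfolding orth_proj_def
proof (rule the_equality)
  fix r assume r: "r \<in> W \<and> y - r \<in> W\<^sup>\<bottom>"
  have "p - r \<in> W" using assms r by (simp add: subspace_diff)
  moreover have "(y - r) - (y - p) \<in> W\<^sup>\<bottom>"
    using r assms(3) subspace_orthogonal_comp subspace_diff by blast
  ultimately have "orthogonal (p - r) (p - r)" by (simp add: orthogonal_comp_def)
  then show "r = p" by (simp add: orthogonal_def)
qed (use assms in simp)

definition normal_plane :: "(complex \<Rightarrow> real ^ 'n) \<Rightarrow> complex \<Rightarrow> (real ^ 'n) set" where
  "normal_plane X z = (span {d_u X z, d_v X z})\<^sup>\<bottom>"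

text \<open>In the next two definitions the factor \<open>e\<^sup>-\<^sup>2\<^sup>\<omega>\<close> is written as the inverse of
  \<open>e\<^sup>2\<^sup>\<omega> = |X\<^sub>u|\<^sup>2\<close>.\<close>

definition ell_xi :: "(complex \<Rightarrow> real ^ 'n) \<Rightarrow> complex \<Rightarrow> real ^ 'n" where
  "ell_xi X z = (1 / (2 * (norm (d_u X z))\<^sup>2)) *\<^sub>R
     orth_proj (normal_plane X z) (d_u (d_u X) z - d_v (d_v X) z)"

definition ell_eta :: "(complex \<Rightarrow> real ^ 'n) \<Rightarrow> complex \<Rightarrow> real ^ 'n" where
  "ell_eta X z = (1 / (norm (d_u X z))\<^sup>2) *\<^sub>R
     orth_proj (normal_plane X z) (d_v (d_u X) z)"

text \<open>The curvature ellipse \<open>{H + \<xi> cos 2\<theta> + \<eta> sin 2\<theta>}\<close> is a circle, or a point.\<close>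
definition curvature_ellipse_is_circle :: "(complex \<Rightarrow> real ^ 'n) \<Rightarrow> complex \<Rightarrow> bool" where
  "curvature_ellipse_is_circle X z \<longleftrightarrow>
     ell_xi X z \<bullet> ell_eta X z = 0 \<and> norm (ell_xi X z) = norm (ell_eta X z)"

definition superminimal_on :: "(complex \<Rightarrow> real ^ 'n) \<Rightarrow> complex set \<Rightarrow> bool" where
  "superminimal_on X M \<longleftrightarrow>
     minimal_immersion_on X M \<and> (\<forall>z\<in>M. curvature_ellipse_is_circle X z)"

text \<open>The Wirtinger derivative \<open>X\<^sub>z = (X\<^sub>u - \<i> X\<^sub>v) / 2\<close>.\<close>
definition d_z :: "(complex \<Rightarrow> real ^ 'n) \<Rightarrow> complex \<Rightarrow> complex ^ 'n" where
  "d_z X z = (\<chi> j. (complex_of_real (d_u X z $ j) - \<i> * complex_of_real (d_v X z $ j)) / 2)"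

definition gauss_map :: "(complex \<Rightarrow> real ^ 4) \<Rightarrow> complex \<Rightarrow> cquat set" where
  "gauss_map X z = proj_class (2 *s d_z X z)"

definition spinor1 :: "(complex \<Rightarrow> real ^ 4) \<Rightarrow> complex \<Rightarrow> (complex ^ 2) set" where
  "spinor1 X z = fst (segre (gauss_map X z))"

definition spinor2 :: "(complex \<Rightarrow> real ^ 4) \<Rightarrow> complex \<Rightarrow> (complex ^ 2) set" where
  "spinor2 X z = snd (segre (gauss_map X z))"

end

theory Submission
  imports Defs "HOL-Complex_Analysis.Conformal_Mappings"
begin

text \<open>Since \<open>\<Phi>\<close> is null, so that \<open>\<Phi>\<close> and \<open>\<Phi>'\<close> are orthogonal, the curvature ellipse of
  \<open>X\<close> is a circle exactly where \<open>\<Phi>'\<close> is null, i.e. where \<open>det (Psi \<Phi>') = 0\<close>.  The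
  factorisation \<open>\<Phi> = A L B\<close> provides holomorphic lifts \<open>u, v\<close> of the spinorial components with
  \<open>Psi \<Phi> = u v\<^sup>t\<close>, and then \<open>det (Psi \<Phi>')\<close> is, up to sign, the product of the Wronskians of
  \<open>u\<close> and of \<open>v\<close>.  On a connected domain this product vanishes iff one of its factors does,
  and a Wronskian vanishes identically iff the corresponding map to the projective line is
  constant.\<close>


section \<open>Derivatives of real parts of holomorphic curves\<close>

definition vec_deriv :: "(complex \<Rightarrow> complex ^ 'n) \<Rightarrow> complex \<Rightarrow> complex ^ 'n" where
  "vec_deriv f z = (\<chi> j. deriv (\<lambda>w. f w $ j) z)"

lemma vec_deriv_nth [simp]: "vec_deriv f z $ j = deriv (\<lambda>w. f w $ j) z"
  by (simp add: vec_deriv_def)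

lemma qRe_nth [simp]: "qRe q $ j = Re (q $ j)"
  by (simp add: qRe_def)

lemma holomorphic_vec_on_vec_deriv:
  assumes "open M" "holomorphic_vec_on f M"
  shows "holomorphic_vec_on (vec_deriv f) M"
  using assms by (simp add: holomorphic_vec_on_def holomorphic_deriv)

lemma holomorphic_primitive_on_vec_deriv:
  assumes "open M" "holomorphic_vec_on f M"
  shows "holomorphic_primitive_on f (vec_deriv f) M"
  using assms holomorphic_derivI
  unfolding holomorphic_vec_on_def holomorphic_primitive_on_def vec_deriv_nth by blast

lemma holomorphic_primitive_on_imp_holomorphic:
  assumes "holomorphic_primitive_on F f M"
  shows "holomorphic_vec_on F M"
  unfolding holomorphic_vec_on_def holomorphic_on_def field_differentiable_def
  using assms unfolding holomorphic_primitive_on_def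
  by (blast intro: has_field_derivative_at_within)

lemma holomorphic_primitive_on_cmult:
  assumes "holomorphic_primitive_on F f M"
  shows "holomorphic_primitive_on (\<lambda>z. c *s F z) (\<lambda>z. c *s f z) M"
  using assms unfolding holomorphic_primitive_on_def by (auto intro: DERIV_cmult)

text \<open>\<open>X\<close> need only agree with \<open>qRe (F w)\<close> on the open set
  \<open>M\<close>, so that the rule also applies to \<open>d_u X\<close> and \<open>d_v X\<close>,
  whose formulas are known on \<open>M\<close> alone.\<close>

lemma has_derivative_qRe:
  assumes "open M" "z \<in> M" "holomorphic_primitive_on F f M" "\<And>w. w \<in> M \<Longrightarrow> X w = qRe (F w)"
  shows "(X has_derivative (\<lambda>h. qRe (h *s f z))) (at z)"
proof -
  have "((\<lambda>w. qRe (F w)) has_derivative (\<lambda>h. qRe (h *s f z))) (at z)"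
  proof (subst has_derivative_componentwise_within, intro ballI)
    fix b :: "real ^ 4" assume "b \<in> Basis"
    then obtain j where b: "b = axis j 1" by (auto simp: Basis_vec_def)
    have "((\<lambda>w. F w $ j) has_derivative (*) (f z $ j)) (at z)"
      using assms unfolding holomorphic_primitive_on_def has_field_derivative_def by blast
    then have "((\<lambda>w. Re (F w $ j)) has_derivative (\<lambda>h. Re (f z $ j * h))) (at z)"
      by (rule has_derivative_Re)
    then show "((\<lambda>w. qRe (F w) \<bullet> b) has_derivative (\<lambda>h. qRe (h *s f z) \<bullet> b)) (at z)"
      by (simp add: b inner_axis mult.commute)
  qed
  then show ?thesis
    by (rule has_derivative_transform_within_open[OF _ assms(1,2)]) (simp add: assms(4))
qed

lemma d_u_qRe:
  assumes "open M" "z \<in> M" "holomorphic_primitive_on F f M" "\<And>w. w \<in> M \<Longrightarrow> X w = qRe (F w)"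
  shows "d_u X z = qRe (f z)"
  using frechet_derivative_at[OF has_derivative_qRe[where X = X and F = F, OF assms]]
  by (metis d_u_def vector_smult_lid)

lemma d_v_qRe:
  assumes "open M" "z \<in> M" "holomorphic_primitive_on F f M" "\<And>w. w \<in> M \<Longrightarrow> X w = qRe (F w)"
  shows "d_v X z = qRe (\<i> *s f z)"
  using frechet_derivative_at[OF has_derivative_qRe[where X = X and F = F, OF assms]]
  by (metis d_v_def)

text \<open>\<open>Re (\<i> * c) = - Im c\<close>, so \<open>d_u X - \<i> d_v X\<close> reassembles
  \<open>f\<close> from its real and imaginary parts.\<close>

lemma d_z_qRe:
  assumes "open M" "z \<in> M" "holomorphic_primitive_on F f M" "\<And>w. w \<in> M \<Longrightarrow> X w = qRe (F w)"
  shows "2 *s d_z X z = f z"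
  by (simp add: d_z_def d_u_qRe[OF assms] d_v_qRe[OF assms] vec_eq_iff complex_eq_iff)

text \<open>The induction generalises over \<open>X\<close> and \<open>F\<close> because
  \<open>d_u X\<close> and \<open>d_v X\<close> are again real parts of holomorphic curves, namely
  of \<open>F'\<close> and \<open>\<i> F'\<close>.\<close>

lemma Ck_on_qRe:
  assumes "open M" "holomorphic_vec_on F M" "\<And>z. z \<in> M \<Longrightarrow> X z = qRe (F z)"
  shows "Ck_on k X M"
  using assms(2,3)
proof (induction k arbitrary: X F)
  case 0
  have "X differentiable (at z)" if "z \<in> M" for z
    using has_derivative_qRe[where X = X and F = F, OF assms(1) that
        holomorphic_primitive_on_vec_deriv[OF assms(1) 0(1)] 0(2)]
    unfolding differentiable_def by blast
  then show ?case
    by (simp add: continuous_at_imp_continuous_on differentiable_imp_continuous_within)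
next
  case (Suc k)
  note prim = holomorphic_primitive_on_vec_deriv[OF assms(1) Suc.prems(1)]
  have der: "holomorphic_vec_on (vec_deriv F) M"
    by (rule holomorphic_vec_on_vec_deriv[OF assms(1) Suc.prems(1)])
  then have der_i: "holomorphic_vec_on (\<lambda>z. \<i> *s vec_deriv F z) M"
    unfolding holomorphic_vec_on_def vector_smult_component
    by (intro allI holomorphic_on_mult holomorphic_on_const) blast
  have "X differentiable (at z)" if "z \<in> M" for z
    using has_derivative_qRe[OF assms(1) that prim Suc.prems(2)] unfolding differentiable_def by blast
  moreover have "Ck_on k (d_u X) M"
    by (rule Suc.IH[OF der]) (rule d_u_qRe[OF assms(1) _ prim Suc.prems(2)])
  moreover have "Ck_on k (d_v X) M"
    by (rule Suc.IH[OF der_i]) (rule d_v_qRe[OF assms(1) _ prim Suc.prems(2)])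
  ultimately show ?case by simp
qed


section \<open>Null curves and the curvature ellipse\<close>

text \<open>The complex bilinear (not Hermitian) form that polarises \<open>qsym\<close>.\<close>

definition qdot :: "cquat \<Rightarrow> cquat \<Rightarrow> complex" where
  "qdot p q = p$0 * q$0 + p$1 * q$1 + p$2 * q$2 + p$3 * q$3"

lemma inner_real4: "(x :: real ^ 4) \<bullet> y = x$0 * y$0 + x$1 * y$1 + x$2 * y$2 + x$3 * y$3"
proof -
  have "(4 :: 4) = 0" by simp
  then show ?thesis unfolding inner_vec_def sum_4 by (simp only:) simp
qed

text \<open>For \<open>q = x + \<i> y\<close> with \<open>x\<close>, \<open>y\<close> real,
  \<open>qsym q = |x|^2 - |y|^2 + 2 \<i> (x \<bullet> y)\<close> and
  \<open>qRe (\<i> *s q) = - y\<close>. Nullity of \<open>\<Phi>\<close> is thus conformality of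
  \<open>X\<close>; the same criterion, applied to the normal part of \<open>\<Phi>'\<close>, is the
  circle condition.\<close>

lemma qsym_eq_0_iff_qRe:
  "qsym q = 0 \<longleftrightarrow> norm (qRe q) = norm (qRe (\<i> *s q)) \<and> qRe q \<bullet> qRe (\<i> *s q) = 0"
proof -
  have "norm (qRe q) = norm (qRe (\<i> *s q)) \<longleftrightarrow> qRe q \<bullet> qRe q = qRe (\<i> *s q) \<bullet> qRe (\<i> *s q)"
    by (simp add: norm_eq)
  moreover have "Re (qsym q) = qRe q \<bullet> qRe q - qRe (\<i> *s q) \<bullet> qRe (\<i> *s q)"
    by (simp add: qsym_def inner_real4 power2_eq_square)
  moreover have "Im (qsym q) = - 2 * (qRe q \<bullet> qRe (\<i> *s q))"
    by (simp add: qsym_def inner_real4 power2_eq_square)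
  ultimately show ?thesis by (auto simp: complex_eq_iff)
qed

lemma qsym_diff_cmult: "qsym (p - c *s q) = qsym p - 2 * c * qdot q p + c\<^sup>2 * qsym q"
  by (simp add: qsym_def qdot_def power2_eq_square algebra_simps)

text \<open>Real and imaginary parts of a null vector have equal length, so they vanish
  together.\<close>

lemma qRe_null_eq_0_iff:
  assumes "qsym q = 0"
  shows "qRe q = 0 \<longleftrightarrow> q = 0"
proof
  assume "qRe q = 0"
  moreover from this have "qRe (\<i> *s q) = 0"
    using assms by (simp add: qsym_eq_0_iff_qRe)
  ultimately have "Re (q $ j) = 0" "Im (q $ j) = 0" for j
    by (auto simp: vec_eq_iff)
  then show "q = 0" by (simp add: vec_eq_iff complex_eq_iff)
qed (simp add: vec_eq_iff)

lemma orth_proj_scaleR: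
  fixes W :: "(real ^ 'n) set"
  assumes "subspace W"
  shows "orth_proj W (r *\<^sub>R y) = r *\<^sub>R orth_proj W y"
proof -
  obtain p q where pq: "p \<in> span W" "\<And>w. w \<in> span W \<Longrightarrow> orthogonal q w" "y = p + q"
    using orthogonal_subspace_decomp_exists[of W y] by blast
  have "span W = W" using assms by (simp add: span_eq_iff)
  with pq have p: "p \<in> W" and q: "q \<in> W\<^sup>\<bottom>"
    by (simp_all add: orthogonal_comp_def orthogonal_commute)
  have "orth_proj W y = p" by (rule orth_proj_eq) (use assms p q pq in auto)
  moreover have "r *\<^sub>R q \<in> W\<^sup>\<bottom>"
    using q by (simp add: subspace_orthogonal_comp subspace_scale)
  then have "orth_proj W (r *\<^sub>R y) = r *\<^sub>R p"
    by (intro orth_proj_eq) (use assms p pq in \<open>auto simp: subspace_scale algebra_simps\<close>)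
  ultimately show ?thesis by simp
qed

text \<open>The condition \<open>qdot q p = 0\<close> makes the projection complex linear: the real and imaginary
  parts of \<open>p\<close> project to those of \<open>p - c q\<close> for one complex number \<open>c\<close>.\<close>
lemma orth_proj_qRe_null:
  assumes "qsym q = 0" "q \<noteq> 0" "qdot q p = 0"
  obtains c where
    "orth_proj ((span {qRe q, qRe (\<i> *s q)})\<^sup>\<bottom>) (qRe p) = qRe (p - c *s q)"
    "orth_proj ((span {qRe q, qRe (\<i> *s q)})\<^sup>\<bottom>) (qRe (\<i> *s p)) = qRe (\<i> *s (p - c *s q))"
proof -
  define P Q P' Q' where PQ: "P = qRe q" "Q = qRe (\<i> *s q)" "P' = qRe p" "Q' = qRe (\<i> *s p)"
  define N where "N = P \<bullet> P"
  have N: "N \<noteq> 0" using assms by (simp add: N_def PQ qRe_null_eq_0_iff)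
  have QQ: "Q \<bullet> Q = N" and [simp]: "P \<bullet> Q = 0" "Q \<bullet> P = 0"
    using assms(1) by (simp_all add: qsym_eq_0_iff_qRe norm_eq N_def PQ inner_commute)
  have "Re (qdot q p) = P \<bullet> P' - Q \<bullet> Q'" "Im (qdot q p) = - (P \<bullet> Q') - Q \<bullet> P'"
    by (simp_all add: qdot_def inner_real4 PQ)
  then have cross: "Q \<bullet> Q' = P \<bullet> P'" "P \<bullet> Q' = - (Q \<bullet> P')" using assms(3) by simp_all
  \<comment> \<open>\<open>P\<close> and \<open>Q\<close> are orthogonal of equal squared length
    \<open>N\<close>, so these are the tangential coordinates of \<open>P'\<close>. By
    \<open>cross\<close>, those of \<open>Q'\<close> are \<open>- \<beta>\<close> and
    \<open>\<alpha>\<close>, which belong to \<open>\<i> * c\<close>.\<close>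
  define \<alpha> \<beta> where \<alpha>\<beta>: "\<alpha> = (P \<bullet> P') / N" "\<beta> = (Q \<bullet> P') / N"
  define c where "c = Complex \<alpha> \<beta>"
  have e1: "qRe (p - c *s q) = P' - \<alpha> *\<^sub>R P - \<beta> *\<^sub>R Q"
    and e2: "qRe (\<i> *s (p - c *s q)) = Q' + \<beta> *\<^sub>R P - \<alpha> *\<^sub>R Q"
    by (simp_all add: vec_eq_iff PQ c_def algebra_simps)
  let ?T = "span {P, Q}"
  have perp: "w \<in> ?T\<^sup>\<bottom>" if "P \<bullet> w = 0" "Q \<bullet> w = 0" for w
    unfolding orthogonal_comp_def
    using orthogonal_to_span[of _ "{P, Q}" w] that by (auto simp: orthogonal_def inner_commute)
  have tan: "w \<in> (?T\<^sup>\<bottom>)\<^sup>\<bottom>" if "w \<in> ?T" for w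
    using that by (auto simp: orthogonal_comp_def orthogonal_commute)
  have PT: "P \<in> ?T" "Q \<in> ?T" by (auto intro: span_base)
  have "orth_proj (?T\<^sup>\<bottom>) P' = P' - \<alpha> *\<^sub>R P - \<beta> *\<^sub>R Q"
  proof (rule orth_proj_eq[OF subspace_orthogonal_comp])
    show "P' - \<alpha> *\<^sub>R P - \<beta> *\<^sub>R Q \<in> ?T\<^sup>\<bottom>"
      by (rule perp) (use N in \<open>simp_all add: inner_diff_right QQ \<alpha>\<beta> flip: N_def\<close>)
    have "\<alpha> *\<^sub>R P + \<beta> *\<^sub>R Q \<in> ?T" using PT by (intro span_add span_mul)
    from tan[OF this] show "P' - (P' - \<alpha> *\<^sub>R P - \<beta> *\<^sub>R Q) \<in> (?T\<^sup>\<bottom>)\<^sup>\<bottom>"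
      by (simp add: algebra_simps)
  qed
  moreover have "orth_proj (?T\<^sup>\<bottom>) Q' = Q' + \<beta> *\<^sub>R P - \<alpha> *\<^sub>R Q"
  proof (rule orth_proj_eq[OF subspace_orthogonal_comp])
    show "Q' + \<beta> *\<^sub>R P - \<alpha> *\<^sub>R Q \<in> ?T\<^sup>\<bottom>"
      by (rule perp)
        (use N in \<open>simp_all add: inner_diff_right inner_add_right QQ \<alpha>\<beta> cross flip: N_def\<close>)
    have "\<alpha> *\<^sub>R Q - \<beta> *\<^sub>R P \<in> ?T" using PT by (intro span_diff span_mul)
    from tan[OF this] show "Q' - (Q' + \<beta> *\<^sub>R P - \<alpha> *\<^sub>R Q) \<in> (?T\<^sup>\<bottom>)\<^sup>\<bottom>"
      by (simp add: algebra_simps)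
  qed
  ultimately show thesis using that[of c] by (simp only: PQ flip: e1[unfolded PQ] e2[unfolded PQ])
qed

text \<open>Differentiate the identity \<open>qsym (f w) = 0\<close>.\<close>

lemma qdot_vec_deriv_null:
  assumes "open M" "z \<in> M" "holomorphic_vec_on f M" "\<And>w. w \<in> M \<Longrightarrow> qsym (f w) = 0"
  shows "qdot (f z) (vec_deriv f z) = 0"
proof -
  have D: "((\<lambda>w. f w $ j) has_field_derivative vec_deriv f z $ j) (at z)" for j
    using holomorphic_primitive_on_vec_deriv[OF assms(1,3)] assms(2)
    unfolding holomorphic_primitive_on_def by blast
  have "((\<lambda>w. qsym (f w)) has_field_derivative 2 * qdot (f z) (vec_deriv f z)) (at z)"
    unfolding qsym_def by (rule derivative_eq_intros D | simp add: qdot_def algebra_simps)+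
  moreover have "((\<lambda>w. qsym (f w)) has_field_derivative 0) (at z)"
    by (rule has_field_derivative_transform_within_open[OF DERIV_const assms(1,2)])
      (simp add: assms(4))
  ultimately show ?thesis using DERIV_unique by fastforce
qed

text \<open>As \<open>f\<close> and \<open>f'\<close> are orthogonal and \<open>f\<close> is null, subtracting a multiple of \<open>f\<close>
  from \<open>f'\<close> does not change its symmetrised norm.\<close>
lemma curvature_ellipse_is_circle_iff:
  assumes "open M" "z \<in> M" "holomorphic_primitive_on F f M" "holomorphic_vec_on f M"
    and "\<And>w. w \<in> M \<Longrightarrow> X w = qRe (F w)" "\<And>w. w \<in> M \<Longrightarrow> qsym (f w) = 0" "f z \<noteq> 0"
  shows "curvature_ellipse_is_circle X z \<longleftrightarrow> qsym (vec_deriv f z) = 0"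
proof -
  let ?p = "vec_deriv f z"
  note prim = holomorphic_primitive_on_vec_deriv[OF assms(1,4)]
  note X_u = d_u_qRe[OF assms(1) _ assms(3,5)] and X_v = d_v_qRe[OF assms(1) _ assms(3,5)]
  have X_uu: "d_u (d_u X) z = qRe ?p" by (rule d_u_qRe[OF assms(1,2) prim X_u])
  have X_uv: "d_v (d_u X) z = qRe (\<i> *s ?p)" by (rule d_v_qRe[OF assms(1,2) prim X_u])
  \<comment> \<open>Each \<open>d_v\<close> contributes a factor \<open>\<i>\<close>, hence the
    sign.\<close>
  have X_vv: "d_v (d_v X) z = - qRe ?p"
    using d_v_qRe[OF assms(1,2) holomorphic_primitive_on_cmult[OF prim] X_v]
    by (simp add: vec_eq_iff)
  have dot: "qdot (f z) ?p = 0" by (rule qdot_vec_deriv_null[OF assms(1,2,4,6)])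
  obtain c where c: "orth_proj (normal_plane X z) (qRe ?p) = qRe (?p - c *s f z)"
    "orth_proj (normal_plane X z) (qRe (\<i> *s ?p)) = qRe (\<i> *s (?p - c *s f z))"
    using orth_proj_qRe_null[OF assms(6)[OF assms(2)] assms(7) dot]
    by (metis normal_plane_def X_u X_v assms(2))
  \<comment> \<open>\<open>w\<close> is the normal part of \<open>\<Phi>'\<close> in complex form:
    up to one common factor, \<open>qRe w\<close> is \<open>\<xi>\<close> and
    \<open>qRe (\<i> *s w)\<close> is \<open>\<eta>\<close>.\<close>
  define w where "w = ?p - c *s f z"
  define N where "N = (norm (d_u X z))\<^sup>2"
  have N: "N \<noteq> 0"
    using assms by (simp add: N_def X_u qRe_null_eq_0_iff)
  have "d_u (d_u X) z - d_v (d_v X) z = 2 *\<^sub>R qRe ?p"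
    by (simp add: X_uu X_vv scaleR_2)
  then have xi: "ell_xi X z = (1 / N) *\<^sub>R qRe w"
    unfolding ell_xi_def by (simp add: normal_plane_def orth_proj_scaleR subspace_orthogonal_comp
        c[unfolded normal_plane_def] w_def N_def)
  have eta: "ell_eta X z = (1 / N) *\<^sub>R qRe (\<i> *s w)"
    by (simp add: ell_eta_def X_uv c w_def N_def)
  have "curvature_ellipse_is_circle X z \<longleftrightarrow> qsym w = 0"
    using N by (auto simp: curvature_ellipse_is_circle_def xi eta qsym_eq_0_iff_qRe)
  also have "qsym w = qsym ?p"
    using assms(2,6) dot by (simp add: w_def qsym_diff_cmult)
  finally show ?thesis .
qed


section \<open>Wronskians and constancy in the projective line\<close>

definition wronskian :: "(complex \<Rightarrow> complex) \<Rightarrow> (complex \<Rightarrow> complex) \<Rightarrow> complex \<Rightarrow> complex" where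
  "wronskian f g z = deriv f z * g z - f z * deriv g z"

lemma holomorphic_on_wronskian:
  assumes "open M" "f holomorphic_on M" "g holomorphic_on M"
  shows "wronskian f g holomorphic_on M"
  unfolding wronskian_def using assms by (intro holomorphic_intros) auto

lemma wronskian_swap: "wronskian g f z = - wronskian f g z"
  by (simp add: wronskian_def algebra_simps)

text \<open>The Wronskian is the numerator of the derivative of \<open>f / g\<close>, so this
  quotient is constant on a ball around \<open>a\<close> where \<open>g\<close> has no zero. The
  cross-multiplied identity makes sense at zeros of \<open>g\<close> too and extends to
  \<open>M\<close> by analytic continuation.\<close>

lemma wronskian_0_imp_proportional:
  assumes "open M" "connected M" "f holomorphic_on M" "g holomorphic_on M"
    and "\<And>z. z \<in> M \<Longrightarrow> wronskian f g z = 0" "a \<in> M" "g a \<noteq> 0" "z \<in> M"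
  shows "f z * g a = f a * g z"
proof -
  have "continuous_on M g" using assms by (simp add: holomorphic_on_imp_continuous_on)
  then have "open (M \<inter> g -` (- {0}))"
    using assms(1) by (rule continuous_open_preimage) auto
  then obtain r where r: "r > 0" "ball a r \<subseteq> M \<inter> g -` (- {0})"
    using openE[of "M \<inter> g -` (- {0})" a] assms(6,7) by blast
  have der: "((\<lambda>w. f w / g w) has_field_derivative 0) (at w within ball a r)" if "w \<in> ball a r" for w
  proof -
    have w: "w \<in> M" "g w \<noteq> 0" using that r by auto
    have "((\<lambda>w. f w / g w) has_field_derivative
        (deriv f w * g w - f w * deriv g w) / (g w * g w)) (at w within ball a r)"
      by (intro DERIV_divide holomorphic_derivI[of _ M] assms w)
    then show ?thesis using assms(5)[OF w(1)] by (simp add: wronskian_def)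
  qed
  obtain k where k: "\<And>w. w \<in> ball a r \<Longrightarrow> f w / g w = k"
    using has_field_derivative_zero_constant[OF convex_ball der] by metis
  have eq: "f w * g a = f a * g w" if "w \<in> ball a r" for w
  proof -
    have "g w \<noteq> 0" using that r by auto
    moreover have "f w / g w = f a / g a" using k[OF that] k[of a] r(1) by simp
    ultimately show ?thesis using assms(7) by (simp add: frac_eq_eq)
  qed
  show ?thesis
    by (rule analytic_continuation_open[of "ball a r" M "\<lambda>w. f w * g a" "\<lambda>w. f a * g w"])
      (use assms r eq in \<open>auto intro!: holomorphic_intros\<close>)
qed

text \<open>Proportionality in the plane is the vanishing of a determinant, a condition that can be
  differentiated.\<close>

lemma proj_class_eq_iff:
  fixes x y :: "complex ^ 2"
  assumes "x \<noteq> 0" "y \<noteq> 0"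
  shows "proj_class x = proj_class y \<longleftrightarrow> x$1 * y$2 = y$1 * x$2"
proof
  assume "proj_class x = proj_class y"
  moreover have "x \<in> proj_class x"
    unfolding proj_class_def by (intro CollectI exI[of _ 1]) simp
  ultimately obtain c where "x = c *s y" by (auto simp: proj_class_def)
  then show "x$1 * y$2 = y$1 * x$2" by simp
next
  assume e: "x$1 * y$2 = y$1 * x$2"
  have "\<exists>c. c \<noteq> 0 \<and> x = c *s y"
  proof (cases "y$1 = 0")
    case True
    with assms e show ?thesis
      by (intro exI[of _ "x$2 / y$2"]) (auto simp: vec_eq_iff forall_2)
  next
    case False
    with assms e show ?thesis
      by (intro exI[of _ "x$1 / y$1"]) (auto simp: vec_eq_iff forall_2 field_simps)
  qed
  then show "proj_class x = proj_class y" by (metis proj_class_scale)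
qed

lemma wronskian_0_iff_proj_class_constant_on:
  fixes u :: "complex \<Rightarrow> complex ^ 2"
  assumes "open M" "connected M" "M \<noteq> {}" "holomorphic_vec_on u M" "\<And>z. z \<in> M \<Longrightarrow> u z \<noteq> 0"
  shows "(\<forall>z\<in>M. wronskian (\<lambda>w. u w $ 1) (\<lambda>w. u w $ 2) z = 0) \<longleftrightarrow>
         (\<lambda>z. proj_class (u z)) constant_on M" (is "?W \<longleftrightarrow> _")
proof -
  obtain a where a: "a \<in> M" using assms(3) by blast
  have hol: "(\<lambda>w. u w $ j) holomorphic_on M" for j
    using assms(4) by (simp add: holomorphic_vec_on_def)
  have "(\<lambda>z. proj_class (u z)) constant_on M \<longleftrightarrow> (\<forall>z\<in>M. proj_class (u z) = proj_class (u a))"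
    using a unfolding constant_on_def by metis
  also have "\<dots> \<longleftrightarrow> (\<forall>z\<in>M. u z $ 1 * u a $ 2 = u a $ 1 * u z $ 2)" (is "_ \<longleftrightarrow> ?P")
    using assms(5) a by (simp add: proj_class_eq_iff)
  also have "\<dots> \<longleftrightarrow> ?W"
  proof
    assume W: ?W
    \<comment> \<open>A non-zero coordinate of \<open>u a\<close> serves as the denominator; in the
      second case the coordinates are swapped.\<close>
    consider "u a $ 2 \<noteq> 0" | "u a $ 1 \<noteq> 0"
      using assms(5)[OF a] by (auto simp: vec_eq_iff forall_2)
    then show ?P
    proof cases
      case 1
      then show ?thesis
        using wronskian_0_imp_proportional[OF assms(1,2) hol hol _ a] W by blast
    next
      case 2
      have "wronskian (\<lambda>w. u w $ 2) (\<lambda>w. u w $ 1) z = 0" if "z \<in> M" for z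
        using W that by (simp add: wronskian_swap[of "\<lambda>w. u w $ 2"])
      from wronskian_0_imp_proportional[OF assms(1,2) hol hol this a 2]
      show ?thesis by (metis mult.commute)
    qed
  next
    assume P: ?P
    show ?W
    proof
      fix z assume z: "z \<in> M"
      let ?d = "\<lambda>j. deriv (\<lambda>w. u w $ j) z"
      have D: "((\<lambda>w. u w $ j) has_field_derivative ?d j) (at z)" for j
        using holomorphic_derivI[OF hol assms(1) z] .
      have "((\<lambda>w. u w $ 1 * u a $ 2 - u a $ 1 * u w $ 2) has_field_derivative
          ?d 1 * u a $ 2 - u a $ 1 * ?d 2) (at z)"
        by (intro DERIV_diff DERIV_cmult DERIV_cmult_right D)
      moreover have "((\<lambda>w. u w $ 1 * u a $ 2 - u a $ 1 * u w $ 2) has_field_derivative 0) (at z)"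
        by (rule has_field_derivative_transform_within_open[OF DERIV_const assms(1) z])
          (use P in simp)
      ultimately have d: "?d 1 * u a $ 2 = u a $ 1 * ?d 2" using DERIV_unique by fastforce
      have p: "u z $ 1 * u a $ 2 = u a $ 1 * u z $ 2" using P z by blast
      \<comment> \<open>Both \<open>u z\<close> and its derivative are parallel to
        \<open>u a\<close>, so their determinant \<open>?w\<close> vanishes; multiplying by a
        coordinate of \<open>u a\<close> avoids division.\<close>
      let ?w = "?d 1 * u z $ 2 - u z $ 1 * ?d 2"
      have "?w * u a $ 1 = 0" "?w * u a $ 2 = 0" using d p by algebra+
      moreover have "u a $ 1 \<noteq> 0 \<or> u a $ 2 \<noteq> 0"
        using assms(5)[OF a] by (auto simp: vec_eq_iff forall_2)
      ultimately show "wronskian (\<lambda>w. u w $ 1) (\<lambda>w. u w $ 2) z = 0"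
        by (auto simp: wronskian_def)
    qed
  qed
  finally show ?thesis by blast
qed

text \<open>Near a point where \<open>g\<close> is non-zero \<open>f\<close> must vanish, and the
  identity theorem spreads this over \<open>M\<close>.\<close>

lemma holomorphic_mult_eq_0:
  assumes "open M" "connected M" "f holomorphic_on M" "g holomorphic_on M"
    and "\<And>z. z \<in> M \<Longrightarrow> f z * g z = 0"
  shows "(\<forall>z\<in>M. f z = 0) \<or> (\<forall>z\<in>M. g z = 0)"
proof (rule disjCI)
  assume "\<not> (\<forall>z\<in>M. g z = 0)"
  then obtain a where a: "a \<in> M" "g a \<noteq> 0" by blast
  have "continuous_on M g" using assms by (simp add: holomorphic_on_imp_continuous_on)
  from continuous_on_open_avoid[OF this assms(1) a]
  obtain r where r: "r > 0" "\<And>y. dist a y < r \<Longrightarrow> g y \<noteq> 0" by blast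
  have "f z = 0" if "z \<in> M" for z
    by (rule analytic_continuation_open[of "M \<inter> ball a r" M f "\<lambda>_. 0"])
      (use assms a r that in \<open>auto intro!: holomorphic_intros\<close>)
  then show "\<forall>z\<in>M. f z = 0" by blast
qed


section \<open>Spinorial components\<close>

text \<open>\<open>Psi\<close> is linear, so the product rule gives the matrix
  \<open>u v'^t + u' v^t\<close>. It is the product of the matrix with columns \<open>u\<close>,
  \<open>u'\<close> and the one with rows \<open>v'\<close>, \<open>v\<close>, whose determinants
  are minus the Wronskian of \<open>u\<close> and the Wronskian of \<open>v\<close>.\<close>

lemma qsym_vec_deriv_outer:
  assumes "open M" "z \<in> M" "holomorphic_vec_on f M" "holomorphic_vec_on u M" "holomorphic_vec_on v M"
    and "\<And>w. w \<in> M \<Longrightarrow> Psi (f w) = outer (u w) (v w)"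
  shows "qsym (vec_deriv f z) =
    - (wronskian (\<lambda>w. u w $ 1) (\<lambda>w. u w $ 2) z * wronskian (\<lambda>w. v w $ 1) (\<lambda>w. v w $ 2) z)"
proof -
  have D: "((\<lambda>w. g w $ j) has_field_derivative deriv (\<lambda>w. g w $ j) z) (at z)"
    if "holomorphic_vec_on g M" for j and g :: "complex \<Rightarrow> complex ^ 'm"
    using that assms(1,2) holomorphic_derivI unfolding holomorphic_vec_on_def by blast
  have "Psi (vec_deriv f z) $ i $ j =
      u z $ i * deriv (\<lambda>w. v w $ j) z + deriv (\<lambda>w. u w $ i) z * v z $ j" for i j
  proof (rule DERIV_unique)
    have "((\<lambda>w. Psi (f w) $ i $ j) has_field_derivative Psi (vec_deriv f z) $ i $ j) (at z)"
      using exhaust_2[of i] exhaust_2[of j]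
      by (auto simp: Psi_def intro!: derivative_eq_intros D[OF assms(3)])
    then show "((\<lambda>w. u w $ i * v w $ j) has_field_derivative Psi (vec_deriv f z) $ i $ j) (at z)"
      by (rule has_field_derivative_transform_within_open[OF _ assms(1,2)])
        (simp add: assms(6) outer_def)
    show "((\<lambda>w. u w $ i * v w $ j) has_field_derivative
        u z $ i * deriv (\<lambda>w. v w $ j) z + deriv (\<lambda>w. u w $ i) z * v z $ j) (at z)"
      by (rule DERIV_mult'[OF D[OF assms(4)] D[OF assms(5)]])
  qed
  then show ?thesis
    unfolding det_Psi[symmetric] det_2 wronskian_def by (simp add: algebra_simps)
qed

text \<open>Euler's four-square identity over the complex numbers; it makes \<open>\<Phi>\<close>
  null because \<open>qL\<close> is.\<close>

lemma qsym_qmul: "qsym (p \<odot> q) = qsym p * qsym q"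
  by (simp add: qsym_def qmul_def power2_eq_square algebra_simps)

text \<open>\<open>Psi qL\<close> is the matrix with the single non-zero entry \<open>2\<close> in the lower right corner, so
  the product picks out the second column of \<open>Psi p\<close> and the second row of \<open>Psi q\<close>.\<close>
lemma Psi_qmul_qL:
  "Psi (p \<odot> qL \<odot> q) =
    outer (vector [Psi p $ 1 $ 2, Psi p $ 2 $ 2]) (vector [2 * Psi q $ 2 $ 1, 2 * Psi q $ 2 $ 2])"
  by (simp add: Psi_def outer_def qmul_def qL_def vec_eq_iff forall_2 algebra_simps)

theorem corollary4p8:
  fixes M :: "complex set"
    and A B \<Phi> F :: "complex \<Rightarrow> cquat"
    and X :: "complex \<Rightarrow> real ^ 4"
  assumes "open M" "M \<noteq> {}" "connected M" "simply_connected M"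
    and "holomorphic_vec_on A M" "\<And>z. z \<in> M \<Longrightarrow> A z \<in> Sp1C"
    and "holomorphic_vec_on B M" "\<And>z. z \<in> M \<Longrightarrow> B z \<in> Sp1C"
    and "\<And>z. z \<in> M \<Longrightarrow> \<Phi> z = A z \<odot> qL \<odot> B z"
    and "holomorphic_primitive_on F \<Phi> M"
    and "\<And>z. z \<in> M \<Longrightarrow> X z = qRe (F z)"
  shows "superminimal_on X M \<longleftrightarrow> spinor1 X constant_on M \<or> spinor2 X constant_on M"
proof -
  define u v :: "complex \<Rightarrow> complex ^ 2"
    where "u = (\<lambda>z. vector [Psi (A z) $ 1 $ 2, Psi (A z) $ 2 $ 2])"
      and "v = (\<lambda>z. vector [2 * Psi (B z) $ 2 $ 1, 2 * Psi (B z) $ 2 $ 2])"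
  have Psi_\<Phi>: "Psi (\<Phi> z) = outer (u z) (v z)" if "z \<in> M" for z
    using that by (simp add: assms(9) Psi_qmul_qL u_def v_def)
  have null: "qsym (\<Phi> z) = 0" if "z \<in> M" for z
    using that by (simp add: assms(9) qsym_qmul) (simp add: qsym_def qL_def)
  have det: "det (Psi (A z)) = 1" "det (Psi (B z)) = 1" if "z \<in> M" for z
    using assms(6,8)[OF that] by (simp_all add: det_Psi Sp1C_def)
  \<comment> \<open>A matrix of determinant 1 has no zero column and no zero row.\<close>
  have u0: "u z \<noteq> 0" and v0: "v z \<noteq> 0" if "z \<in> M" for z
    using det[OF that] by (auto simp: u_def v_def det_2 vec_eq_iff forall_2)
  have \<Phi>0: "\<Phi> z \<noteq> 0" if "z \<in> M" for z
  proof
    assume "\<Phi> z = 0"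
    then have "outer (u z) (v z) = 0"
      using Psi_\<Phi>[OF that] by (simp add: Psi_def vec_eq_iff forall_2)
    then have "u z $ i * v z $ j = 0" for i j by (auto simp: outer_def vec_eq_iff)
    then show False using u0[OF that] v0[OF that] by (simp add: vec_eq_iff) metis
  qed
  have hol_A: "(\<lambda>z. A z $ j) holomorphic_on M" and hol_B: "(\<lambda>z. B z $ j) holomorphic_on M" for j
    using assms(5,7) by (simp_all add: holomorphic_vec_on_def)
  have hol_u: "holomorphic_vec_on u M"
    using hol_A by (auto simp: holomorphic_vec_on_def u_def Psi_def forall_2 intro!: holomorphic_intros)
  have hol_v: "holomorphic_vec_on v M"
    using hol_B by (auto simp: holomorphic_vec_on_def v_def Psi_def forall_2 intro!: holomorphic_intros)
  have "holomorphic_vec_on (\<lambda>z. A z \<odot> qL \<odot> B z) M"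
    using hol_A hol_B
    by (auto simp: holomorphic_vec_on_def qmul_def qL_def forall_index4 intro!: holomorphic_intros)
  then have hol_\<Phi>: "holomorphic_vec_on \<Phi> M"
    using assms(9) unfolding holomorphic_vec_on_def by (metis (no_types, lifting) holomorphic_transform)

  let ?U = "wronskian (\<lambda>w. u w $ 1) (\<lambda>w. u w $ 2)" and ?V = "wronskian (\<lambda>w. v w $ 1) (\<lambda>w. v w $ 2)"
  note der = has_derivative_qRe[OF assms(1) _ assms(10,11)]
  note X_u = d_u_qRe[OF assms(1) _ assms(10,11)] and X_v = d_v_qRe[OF assms(1) _ assms(10,11)]
  note prim = holomorphic_primitive_on_vec_deriv[OF assms(1) hol_\<Phi>]

  have "smooth_on X M"
    unfolding smooth_on_def
    using Ck_on_qRe[OF assms(1) holomorphic_primitive_on_imp_holomorphic[OF assms(10)] assms(11)]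
    by blast
  moreover have "inj (frechet_derivative X (at z))" if z: "z \<in> M" for z
  proof -
    \<comment> \<open>Multiples of a null vector are null, so a direction killed by the differential
      of \<open>X\<close> satisfies \<open>h *s \<Phi> z = 0\<close>.\<close>
    have "h = 0" if "qRe (h *s \<Phi> z) = 0" for h
    proof -
      have "qsym (h *s \<Phi> z) = 0"
        using null[OF z] by (simp add: qsym_def power_mult_distrib flip: distrib_left)
      then have "h *s \<Phi> z = 0" using that by (simp add: qRe_null_eq_0_iff)
      then show ?thesis using \<Phi>0[OF z] by simp
    qed
    moreover have "linear (\<lambda>h. qRe (h *s \<Phi> z))"
      using der[OF z] by (rule has_derivative_linear)
    ultimately show ?thesis
      by (simp add: linear_injective_0 flip: frechet_derivative_at[OF der[OF z]])
  qed
  ultimately have "conformal_immersion_on X M"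
    using null by (auto simp: conformal_immersion_on_def immersion_on_def X_u X_v qsym_eq_0_iff_qRe)
  moreover have "d_u (d_u X) z + d_v (d_v X) z = 0" if "z \<in> M" for z
    using d_u_qRe[OF assms(1) that prim X_u]
      d_v_qRe[OF assms(1) that holomorphic_primitive_on_cmult[OF prim] X_v]
    by (simp add: vec_eq_iff)
  ultimately have "minimal_immersion_on X M" by (simp add: minimal_immersion_on_def)
  then have "superminimal_on X M \<longleftrightarrow> (\<forall>z\<in>M. qsym (vec_deriv \<Phi> z) = 0)"
    using curvature_ellipse_is_circle_iff[OF assms(1) _ assms(10) hol_\<Phi> assms(11) null \<Phi>0]
    by (auto simp: superminimal_on_def)
  also have "\<dots> \<longleftrightarrow> (\<forall>z\<in>M. ?U z * ?V z = 0)"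
    using qsym_vec_deriv_outer[OF assms(1) _ hol_\<Phi> hol_u hol_v Psi_\<Phi>] by simp
  also have "\<dots> \<longleftrightarrow> (\<forall>z\<in>M. ?U z = 0) \<or> (\<forall>z\<in>M. ?V z = 0)"
    using holomorphic_mult_eq_0[OF assms(1,3), of ?U ?V] hol_u hol_v assms(1)
    by (auto simp: holomorphic_vec_on_def holomorphic_on_wronskian)
  also have "\<dots> \<longleftrightarrow> (\<lambda>z. proj_class (u z)) constant_on M \<or> (\<lambda>z. proj_class (v z)) constant_on M"
    using wronskian_0_iff_proj_class_constant_on[OF assms(1,3,2)] hol_u hol_v u0 v0 by simp
  also have "\<dots> \<longleftrightarrow> spinor1 X constant_on M \<or> spinor2 X constant_on M"
  proof -
    \<comment> \<open>Since \<open>2 *s d_z X z\<close> equals \<open>\<Phi> z\<close>, the factors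
      \<open>u z\<close> and \<open>v z\<close> represent the two spinorial components.\<close>
    have "segre (gauss_map X z) = (proj_class (u z), proj_class (v z))" if "z \<in> M" for z
      unfolding gauss_map_def
        d_z_qRe[where X = X and F = F, OF assms(1) that assms(10,11), simplified]
      by (rule segre_eq[OF \<Phi>0 null u0 v0 Psi_\<Phi>]) (rule that)+
    then show ?thesis by (simp add: constant_on_def spinor1_def spinor2_def)
  qed
  finally show ?thesis .
qed

end
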